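(* Let $1<p<\infty$ and let $(c,d)$ be the subordinated pair for a matching pair $(a,b)\in L^\infty\times L^\infty$. Then, for operators acting on $H^p$, $$\ker T(c)=\operatorname{im}\mathbf{P}_c^-\dotplus\operatorname{im}\mathbf{P}_c^+,\qquad \operatorname{im}\mathbf{P}_c^-\subset\ker(T(a)+H(b)),\qquad \operatorname{im}\mathbf{P}_c^+\subset\ker(T(a)-H(b)).$$
   Context: $\mathbb{T}$ is the unit circle, $L^p=L^p(\mathbb{T})$, $H^p=\{f\in L^p:\widehat f_n=0\text{ for }n<0\}$. $P$ is the Riesz projection of $L^p$ onto $H^p$, $Q=I-P$, $(Jf)(t)=\overline tf(\overline t)$, $\widetilde a(t)=a(1/t)$; $T(a)f=P(af)$, $H(a)f=PaQJf$ on $H^p$ for $a\in L^\infty$. A matching pair $(a,b)$ consists of $a\in L^\infty$ invertible in $L^\infty$ and $b\in L^\infty$ with $a\widetilde a=b\widetilde b$ (then $b$ is invertible too). Its subordinated pair is $(c,d)$ with $c=ab^{-1}=\widetilde b\widetilde a^{-1}$, $d=b\widetilde a^{-1}=a\widetilde b^{-1}$; then $c\widetilde c=d\widetilde d=1$. For $g\in L^\infty$ with $g\widetilde g=1$, $\mathbf{P}_g:=JQgP|_{\ker T(g)}$ maps $\ker T(g)$ into itself with $\mathbf{P}_g^2=I$, and $\mathbf{P}_g^{\pm}:=\frac12(I\pm\mathbf{P}_g)$ on $\ker T(g)$. *)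

theory Defs
  imports "HOL-Probability.Probability"
begin

section \<open>Measurable functions on the unit circle, modulo equality almost everywhere\<close>

text \<open>Normalised arc length. The symmetric parameter interval makes the invariance
  under conjugation immediate.\<close>

definition circle :: "complex measure" where
  "circle = distr (uniform_measure lborel {-pi..pi}) (restrict_space borel (sphere 0 1)) cis"

lemma space_circle: "space circle = sphere 0 1"
  by (simp add: circle_def space_restrict_space)

lemma sets_circle [measurable_cong]: "sets circle = sets (restrict_space borel (sphere 0 1))"
  by (simp add: circle_def)

lemma cis_measurable_circle:
  "cis \<in> measurable (uniform_measure lborel {-pi..pi}) (restrict_space borel (sphere 0 1))"
proof (rule measurable_restrict_space2)
  have "continuous_on UNIV cis" by (intro continuous_intros)
  then have "cis \<in> borel_measurable borel" by (rule borel_measurable_continuous_onI)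
  then show "cis \<in> borel_measurable (uniform_measure lborel {-pi..pi})" by simp
qed simp

lemma prob_space_circle: "prob_space circle"
proof -
  have "prob_space (uniform_measure lborel {-pi..pi})"
    by (rule prob_space_uniform_measure) (auto simp: pi_gt_zero less_imp_le)
  then show ?thesis
    unfolding circle_def by (rule prob_space.prob_space_distr) (rule cis_measurable_circle)
qed

lemma circle_measurable_self: "(\<lambda>t. t) \<in> borel_measurable circle"
  unfolding measurable_cong_sets[OF sets_circle refl]
  by (rule measurable_restrict_space1) simp

lemma cnj_borel: "cnj \<in> borel_measurable borel"
  by (intro borel_measurable_continuous_onI continuous_intros)

lemma cnj_measurable_circle: "cnj \<in> measurable circle circle"
  unfolding measurable_cong_sets[OF sets_circle sets_circle]
  by (intro measurable_restrict_space2 measurable_restrict_space1)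
    (auto simp: space_restrict_space cnj_borel)

lemma inverse_measurable_circle: "(\<lambda>t. 1 / t) \<in> measurable circle circle"
proof -
  have "1 / t = cnj t" if "t \<in> space circle" for t
    using that by (simp add: space_circle complex_div_cnj[of 1])
  then show ?thesis
    using cnj_measurable_circle measurable_cong[of circle "\<lambda>t. 1 / t" cnj circle] by blast
qed

lemma distr_cnj_circle: "distr circle circle cnj = circle"
proof -
  let ?I = "uniform_measure lborel {-pi..pi}" and ?S = "restrict_space borel (sphere 0 1)"
  have neg: "distr ?I ?I uminus = ?I"
  proof (rule measure_eqI)
    fix A assume "A \<in> sets (distr ?I ?I uminus)"
    then have A: "A \<in> sets borel" by simp
    have m: "(uminus :: real \<Rightarrow> real) \<in> borel_measurable borel" by simp
    have A': "uminus -` A \<in> sets (borel :: real measure)"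
      using measurable_sets[OF m A] by simp
    have "emeasure lborel ({-pi..pi} \<inter> uminus -` A) = emeasure lborel ({-pi..pi} \<inter> A)"
    proof -
      have "emeasure lborel ({-pi..pi} \<inter> A)
          = emeasure (distr lborel borel uminus) ({-pi..pi} \<inter> A)"
        by (simp add: lborel_distr_uminus)
      also have "\<dots> = emeasure lborel (uminus -` ({-pi..pi} \<inter> A))"
        using A by (subst emeasure_distr) auto
      also have "uminus -` ({-pi..pi} \<inter> A) = {-pi..pi} \<inter> uminus -` A" by auto
      finally show ?thesis by simp
    qed
    then show "emeasure (distr ?I ?I uminus) A = emeasure ?I A"
      using A A' by (subst emeasure_distr) (auto simp: emeasure_uniform_measure)
  qed simp
  have "distr circle circle cnj = distr ?I ?S (cnj \<circ> cis)"
    unfolding circle_def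
    by (subst distr_distr)
      (use cnj_measurable_circle cis_measurable_circle
        in \<open>auto simp: measurable_cong_sets[OF sets_circle sets_circle] intro!: distr_cong\<close>)
  also have "cnj \<circ> cis = cis \<circ> uminus" by (auto simp: cis_cnj)
  also have "distr ?I ?S (cis \<circ> uminus) = distr (distr ?I ?I uminus) ?S cis"
    by (subst distr_distr) (auto simp: cis_measurable_circle)
  finally show ?thesis by (simp add: neg circle_def)
qed

lemma AE_circle_cnj:
  assumes "AE t in circle. R t"
  shows "AE t in circle. R (cnj t)"
proof -
  have "AE t in distr circle circle cnj. R t" unfolding distr_cnj_circle by (rule assms)
  then show ?thesis by (rule AE_distrD[OF cnj_measurable_circle])
qed

lemma AE_circle_inverse:
  assumes "AE t in circle. R t"
  shows "AE t in circle. R (1 / t)"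
  using AE_circle_cnj[OF assms] AE_space
proof eventually_elim
  case (elim t)
  then have "1 / t = cnj t" by (simp add: space_circle complex_div_cnj[of 1])
  with elim show ?case by simp
qed

definition circle_eq :: "(complex \<Rightarrow> complex) \<Rightarrow> (complex \<Rightarrow> complex) \<Rightarrow> bool" where
  "circle_eq f g \<longleftrightarrow> f \<in> borel_measurable circle \<and> g \<in> borel_measurable circle
     \<and> (AE t in circle. f t = g t)"

lemma circle_eq_pointwise:
  assumes "f \<in> borel_measurable circle" "\<And>t. f t = g t"
  shows "circle_eq f g"
proof -
  have "f = g" using assms(2) by (rule ext)
  with assms(1) show ?thesis by (simp add: circle_eq_def)
qed

quotient_type circle_fun = "complex \<Rightarrow> complex" / partial: circle_eq
proof (rule part_equivpI)
  show "\<exists>f. circle_eq f f"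
    by (rule exI[of _ "\<lambda>_. 0"]) (simp add: circle_eq_def)
  show "symp circle_eq" by (auto simp: symp_def circle_eq_def)
  show "transp circle_eq"
    by (rule transpI) (auto simp: circle_eq_def elim: eventually_elim2)
qed

text \<open>The operations are pointwise. Accordingly, \<^term>\<open>inverse\<close> takes the value 0 where the
  function vanishes; it is the ring inverse of every function that is nonzero almost everywhere.\<close>

instantiation circle_fun :: "{comm_ring_1, inverse}"
begin

lift_definition zero_circle_fun :: circle_fun is "\<lambda>_. 0" by (simp add: circle_eq_def)
lift_definition one_circle_fun :: circle_fun is "\<lambda>_. 1" by (simp add: circle_eq_def)
lift_definition plus_circle_fun :: "circle_fun \<Rightarrow> circle_fun \<Rightarrow> circle_fun"
  is "\<lambda>f g t. f t + g t" by (auto simp: circle_eq_def)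
lift_definition minus_circle_fun :: "circle_fun \<Rightarrow> circle_fun \<Rightarrow> circle_fun"
  is "\<lambda>f g t. f t - g t" by (auto simp: circle_eq_def)
lift_definition uminus_circle_fun :: "circle_fun \<Rightarrow> circle_fun"
  is "\<lambda>f t. - f t" by (auto simp: circle_eq_def)
lift_definition times_circle_fun :: "circle_fun \<Rightarrow> circle_fun \<Rightarrow> circle_fun"
  is "\<lambda>f g t. f t * g t" by (auto simp: circle_eq_def)
lift_definition inverse_circle_fun :: "circle_fun \<Rightarrow> circle_fun"
  is "\<lambda>f t. inverse (f t)" by (auto simp: circle_eq_def)
lift_definition divide_circle_fun :: "circle_fun \<Rightarrow> circle_fun \<Rightarrow> circle_fun"
  is "\<lambda>f g t. f t / g t" by (auto simp: circle_eq_def)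

instance
proof
  show "(0::circle_fun) \<noteq> 1"
  proof (transfer, unfold circle_eq_def, rule notI)
    interpret prob_space circle by (rule prob_space_circle)
    assume "(\<lambda>_. 0 :: complex) \<in> borel_measurable circle \<and>
      (\<lambda>_. 1 :: complex) \<in> borel_measurable circle \<and> (AE t in circle. (0::complex) = 1)"
    then show False by simp
  qed
qed (transfer, rule circle_eq_pointwise; (simp add: circle_eq_def algebra_simps)?)+

end

lift_definition cscale :: "complex \<Rightarrow> circle_fun \<Rightarrow> circle_fun"
  is "\<lambda>z f t. z * f t" by (auto simp: circle_eq_def)

lemma vector_space_cscale: "vector_space cscale"
  by unfold_locales
    (transfer, rule circle_eq_pointwise; (simp add: circle_eq_def algebra_simps)?)+


section \<open>Lebesgue and Hardy spaces\<close>

lift_definition fourier_coeff :: "circle_fun \<Rightarrow> int \<Rightarrow> complex"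
  is "\<lambda>f n. LINT t|circle. f t * t powi (- n)"
proof (rule ext)
  fix f g :: "complex \<Rightarrow> complex" and n :: int
  assume fg: "circle_eq f g"
  have [measurable]: "f \<in> borel_measurable circle" "g \<in> borel_measurable circle"
    using fg by (auto simp: circle_eq_def)
  have [measurable]: "(\<lambda>t. t powi (- n)) \<in> borel_measurable circle"
    using circle_measurable_self by (cases "0 \<le> - n") (auto simp: power_int_def)
  show "(LINT t|circle. f t * t powi (- n)) = (LINT t|circle. g t * t powi (- n))"
    by (rule integral_cong_AE) (use fg in \<open>auto simp: circle_eq_def\<close>)
qed

lift_definition in_Lp :: "real \<Rightarrow> circle_fun \<Rightarrow> bool"
  is "\<lambda>p f. integrable circle (\<lambda>t. norm (f t) powr p)"
proof -
  fix p :: real and f g :: "complex \<Rightarrow> complex"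
  assume fg: "circle_eq f g"
  have [measurable]: "f \<in> borel_measurable circle" "g \<in> borel_measurable circle"
    using fg by (auto simp: circle_eq_def)
  show "integrable circle (\<lambda>t. norm (f t) powr p) = integrable circle (\<lambda>t. norm (g t) powr p)"
    by (rule integrable_cong_AE) (use fg in \<open>auto simp: circle_eq_def\<close>)
qed

lift_definition in_Linf :: "circle_fun \<Rightarrow> bool"
  is "\<lambda>f. \<exists>B. AE t in circle. norm (f t) \<le> B"
proof -
  fix f g :: "complex \<Rightarrow> complex"
  assume "circle_eq f g"
  then have "AE t in circle. f t = g t" by (simp add: circle_eq_def)
  then have "(AE t in circle. norm (f t) \<le> B) \<longleftrightarrow> (AE t in circle. norm (g t) \<le> B)" for B
    by (intro eventually_cong) auto
  then show "(\<exists>B. AE t in circle. norm (f t) \<le> B) = (\<exists>B. AE t in circle. norm (g t) \<le> B)"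
    by simp
qed

definition Lp :: "real \<Rightarrow> circle_fun set" where
  "Lp p = {f. in_Lp p f}"

definition Linf :: "circle_fun set" where
  "Linf = {f. in_Linf f}"

definition hardy :: "real \<Rightarrow> circle_fun set" where
  "hardy p = {f \<in> Lp p. \<forall>n<0. fourier_coeff f n = 0}"

lift_definition tilde :: "circle_fun \<Rightarrow> circle_fun"
  is "\<lambda>f t. f (1 / t)"
proof -
  fix f g :: "complex \<Rightarrow> complex"
  assume fg: "circle_eq f g"
  have "(\<lambda>t. h (1 / t)) \<in> borel_measurable circle"
    if "h \<in> borel_measurable circle" for h :: "complex \<Rightarrow> complex"
    using measurable_compose[OF inverse_measurable_circle that] .
  moreover have "AE t in circle. f (1 / t) = g (1 / t)"
    using fg AE_circle_inverse[of "\<lambda>t. f t = g t"] by (simp add: circle_eq_def)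
  ultimately show "circle_eq (\<lambda>t. f (1 / t)) (\<lambda>t. g (1 / t))"
    using fg by (simp add: circle_eq_def)
qed

lift_definition flip :: "circle_fun \<Rightarrow> circle_fun"
  is "\<lambda>f t. cnj t * f (cnj t)"
proof -
  fix f g :: "complex \<Rightarrow> complex"
  assume fg: "circle_eq f g"
  have [measurable]: "cnj \<in> borel_measurable circle"
    using measurable_compose[OF circle_measurable_self cnj_borel] .
  have [measurable]: "(\<lambda>t. h (cnj t)) \<in> borel_measurable circle"
    if "h \<in> borel_measurable circle" for h :: "complex \<Rightarrow> complex"
    using measurable_compose[OF cnj_measurable_circle that] .
  have "AE t in circle. f (cnj t) = g (cnj t)"
    using fg AE_circle_cnj[of "\<lambda>t. f t = g t"] by (simp add: circle_eq_def)
  then show "circle_eq (\<lambda>t. cnj t * f (cnj t)) (\<lambda>t. cnj t * g (cnj t))"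
    using fg by (auto simp: circle_eq_def)
qed


section \<open>Toeplitz and Hankel operators\<close>

text \<open>The Riesz projection discards the Fourier coefficients of negative index. For
  \<open>1 < p < \<infinity>\<close> and \<open>f \<in> L\<^sup>p\<close> the function \<open>g\<close> below exists by the theorem of M. Riesz and is
  unique because Fourier coefficients determine a function, so on \<open>L\<^sup>p\<close> the else branch never
  applies; it only makes the operator total on the type of all measurable functions.\<close>

definition riesz_P :: "real \<Rightarrow> circle_fun \<Rightarrow> circle_fun" where
  "riesz_P p f =
    (if \<exists>!g. g \<in> hardy p \<and> (\<forall>n\<ge>0. fourier_coeff g n = fourier_coeff f n)
     then THE g. g \<in> hardy p \<and> (\<forall>n\<ge>0. fourier_coeff g n = fourier_coeff f n)
     else f)"

definition riesz_Q :: "real \<Rightarrow> circle_fun \<Rightarrow> circle_fun" where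
  "riesz_Q p f = f - riesz_P p f"

definition toeplitz :: "real \<Rightarrow> circle_fun \<Rightarrow> circle_fun \<Rightarrow> circle_fun" where
  "toeplitz p a f = riesz_P p (a * f)"

definition hankel :: "real \<Rightarrow> circle_fun \<Rightarrow> circle_fun \<Rightarrow> circle_fun" where
  "hankel p a f = riesz_P p (a * riesz_Q p (flip f))"

text \<open>Kernel of an operator acting on \<open>H\<^sup>p\<close>.\<close>

definition hardy_ker :: "real \<Rightarrow> (circle_fun \<Rightarrow> circle_fun) \<Rightarrow> circle_fun set" where
  "hardy_ker p A = {f \<in> hardy p. A f = 0}"

definition direct_sum :: "circle_fun set \<Rightarrow> circle_fun set \<Rightarrow> circle_fun set \<Rightarrow> bool" where
  "direct_sum V U W \<longleftrightarrow>
     module.subspace cscale V \<and> module.subspace cscale U \<and> module.subspace cscale W \<and>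
     V = {u + w | u w. u \<in> U \<and> w \<in> W} \<and> U \<inter> W = {0}"


section \<open>Matching pairs\<close>

definition invertible_Linf :: "circle_fun \<Rightarrow> bool" where
  "invertible_Linf a \<longleftrightarrow> a \<in> Linf \<and> (\<exists>u\<in>Linf. a * u = 1)"

definition matching_pair :: "circle_fun \<Rightarrow> circle_fun \<Rightarrow> bool" where
  "matching_pair a b \<longleftrightarrow> invertible_Linf a \<and> b \<in> Linf \<and> a * tilde a = b * tilde b"

text \<open>For a matching pair, \<open>b\<close> is also invertible in \<open>L\<^sup>\<infinity>\<close>, so the pointwise inverses below are
  inverses in \<open>L\<^sup>\<infinity>\<close>.\<close>

definition subordinated_pair ::
  "circle_fun \<Rightarrow> circle_fun \<Rightarrow> circle_fun \<Rightarrow> circle_fun \<Rightarrow> bool" where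
  "subordinated_pair a b c d \<longleftrightarrow> c = a * inverse b \<and> d = b * inverse (tilde a)"

definition bold_P :: "real \<Rightarrow> circle_fun \<Rightarrow> circle_fun \<Rightarrow> circle_fun" where
  "bold_P p g f = flip (riesz_Q p (g * riesz_P p f))"

definition bold_P_plus :: "real \<Rightarrow> circle_fun \<Rightarrow> circle_fun \<Rightarrow> circle_fun" where
  "bold_P_plus p g f = cscale (1/2) (f + bold_P p g f)"

definition bold_P_minus :: "real \<Rightarrow> circle_fun \<Rightarrow> circle_fun \<Rightarrow> circle_fun" where
  "bold_P_minus p g f = cscale (1/2) (f - bold_P p g f)"

text \<open>The operators \<^const>\<open>bold_P_plus\<close> and \<^const>\<open>bold_P_minus\<close> live on the kernel of the
  Toeplitz operator; their images are taken over that kernel.\<close>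

definition im_P_plus :: "real \<Rightarrow> circle_fun \<Rightarrow> circle_fun set" where
  "im_P_plus p g = bold_P_plus p g ` hardy_ker p (toeplitz p g)"

definition im_P_minus :: "real \<Rightarrow> circle_fun \<Rightarrow> circle_fun set" where
  "im_P_minus p g = bold_P_minus p g ` hardy_ker p (toeplitz p g)"

end

(* If f lies in ker T(c), then all nonnegative Fourier coefficients of c f vanish, so P_c f = J(c f).
   Since c J(c f) = (c c~) J f = J f, the map P_c is an involution of ker T(c), and the images of
   P_c^- and P_c^+ are its eigenspaces for -1 and 1. On these c f = -J f resp. c f = J f, and
   multiplication by b gives b J f = -a f resp. b J f = a f, where J f = Q J f for f in H^p.
   The only analytic input is that Fourier coefficients determine an integrable function; the
   boundedness of the Riesz projection is not used. *)

theory Submission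
  imports Defs
begin

section \<open>Measurability and integrability on the circle\<close>

interpretation circle: prob_space circle
  by (rule prob_space_circle)

declare circle_measurable_self [measurable]

lemma power_int_measurable_circle [measurable]: "(\<lambda>t. t powi n) \<in> borel_measurable circle"
  using circle_measurable_self by (cases "0 \<le> n") (auto simp: power_int_def)

lemma cnj_borel_measurable_circle [measurable]: "cnj \<in> borel_measurable circle"
  using measurable_compose[OF circle_measurable_self cnj_borel] .

lemma measurable_circle_cnj_arg [measurable]:
  "f \<in> borel_measurable circle \<Longrightarrow> (\<lambda>t. f (cnj t)) \<in> borel_measurable circle"
  using measurable_compose[OF cnj_measurable_circle] .

lemma measurable_circle_inverse_arg [measurable]:
  "f \<in> borel_measurable circle \<Longrightarrow> (\<lambda>t. f (1 / t)) \<in> borel_measurable circle"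
  using measurable_compose[OF inverse_measurable_circle] .

lemma AE_circle_norm: "AE t in circle. norm t = 1"
  using AE_space by eventually_elim (simp add: space_circle)

lemma integrable_circle_bounded_mult:
  assumes "integrable circle f" "u \<in> borel_measurable circle" "AE t in circle. norm (u t) \<le> B"
  shows "integrable circle (\<lambda>t. u t * f t :: complex)"
proof (rule Bochner_Integration.integrable_bound)
  show "integrable circle (\<lambda>t. \<bar>B\<bar> * norm (f t))" using assms(1) by simp
  show "(\<lambda>t. u t * f t) \<in> borel_measurable circle" using assms by measurable
  show "AE t in circle. norm (u t * f t) \<le> norm (\<bar>B\<bar> * norm (f t))"
    using assms(3) by eventually_elim (auto simp: norm_mult abs_mult intro!: mult_right_mono)
qed

lemma integrable_circle_powi:
  assumes "integrable circle f"
  shows "integrable circle (\<lambda>t. f t * t powi n)"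
proof -
  have "AE t in circle. norm (t powi n) \<le> 1"
    using AE_circle_norm by eventually_elim (simp add: norm_power_int)
  from integrable_circle_bounded_mult[OF assms _ this] show ?thesis
    by (simp add: mult.commute)
qed

section \<open>An integrable function whose Fourier coefficients all vanish is zero almost
  everywhere\<close>

definition fourier_null :: "(complex \<Rightarrow> complex) \<Rightarrow> bool" where
  "fourier_null f \<longleftrightarrow> integrable circle f \<and> (\<forall>n. (LINT t|circle. f t * t powi n) = 0)"

lemma fourier_null_add:
  assumes "fourier_null f" "fourier_null g"
  shows "fourier_null (\<lambda>t. f t + g t)"
  using assms by (auto simp: fourier_null_def ring_distribs integrable_circle_powi)

lemma fourier_null_cmult:
  assumes "fourier_null f"
  shows "fourier_null (\<lambda>t. z * f t)"
  using assms by (auto simp: fourier_null_def mult.assoc)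

text \<open>A power of t only shifts the index of the moments. The law of exponents can fail at t =
  0, hence the passage through points of norm 1.\<close>

lemma fourier_null_powi:
  assumes "fourier_null f"
  shows "fourier_null (\<lambda>t. f t * t powi m)"
proof -
  have "(LINT t|circle. f t * t powi m * t powi n) = (LINT t|circle. f t * t powi (m + n))" for n
  proof (rule integral_cong_AE)
    show "AE t in circle. f t * t powi m * t powi n = f t * t powi (m + n)"
      using AE_circle_norm by eventually_elim (subst power_int_add; force)
  qed (use assms in \<open>auto simp: fourier_null_def\<close>)
  with assms show ?thesis by (simp add: fourier_null_def integrable_circle_powi)
qed

lemma fourier_null_cong_AE:
  assumes "fourier_null f" "g \<in> borel_measurable circle" "AE t in circle. f t = g t"
  shows "fourier_null g"
proof -
  have [measurable]: "f \<in> borel_measurable circle" "g \<in> borel_measurable circle"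
    using assms by (auto simp: fourier_null_def)
  have "integrable circle g"
    using assms(1) unfolding fourier_null_def by (blast intro: integrable_cong_AE_imp assms)
  moreover have "(LINT t|circle. g t * t powi n) = (LINT t|circle. f t * t powi n)" for n
    by (rule integral_cong_AE) (use assms in \<open>auto elim: eventually_mono\<close>)
  ultimately show ?thesis using assms by (simp add: fourier_null_def)
qed

text \<open>On the circle \<open>cnj t\<close> is t to the power -1, so a real polynomial in Re t
  and Im t acts as a trigonometric polynomial and multiplication by it combines shifts of moments.
  The induction keeps f arbitrary: for a product, the hypothesis for the factor g is applied to h *
  f in place of f.\<close>

lemma fourier_null_real_polynomial:
  assumes "real_polynomial_function h" "fourier_null f"
  shows "fourier_null (\<lambda>t. of_real (h t) * f t)"
  using assms
proof (induction arbitrary: f rule: real_polynomial_function.induct)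
  case (linear h)
  \<comment> \<open>The coefficients (u - i v) / 2 and (u + i v) / 2 come from Re t = (t + cnj t) /
    2 and Im t = (t - cnj t) / (2 i).\<close>
  define u v where "u = complex_of_real (h 1)" and "v = complex_of_real (h \<i>)"
  have h: "h t = Re t * h 1 + Im t * h \<i>" for t
  proof -
    have "h t = h (Re t *\<^sub>R 1 + Im t *\<^sub>R \<i>)"
      by (rule arg_cong[of _ _ h]) (simp add: complex_eq_iff)
    then show ?thesis using linear(1) by (simp add: bounded_linear.linear linear_add linear_scale)
  qed
  have "fourier_null (\<lambda>t. (u - \<i> * v) / 2 * (f t * t powi 1) + (u + \<i> * v) / 2 * (f t * t powi (-1)))"
    using linear(2) by (intro fourier_null_add fourier_null_cmult fourier_null_powi)
  then show ?case
  proof (rule fourier_null_cong_AE)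
    have "h \<in> borel_measurable borel"
      using linear(1) by (intro borel_measurable_continuous_onI linear_continuous_on)
    then have "h \<in> borel_measurable circle"
      using measurable_compose[OF circle_measurable_self] by blast
    then show "(\<lambda>t. of_real (h t) * f t) \<in> borel_measurable circle"
      using linear(2) by (auto simp: fourier_null_def)
    show "AE t in circle. (u - \<i> * v) / 2 * (f t * t powi 1) + (u + \<i> * v) / 2 * (f t * t powi (-1))
        = of_real (h t) * f t"
      using AE_circle_norm
    proof eventually_elim
      case (elim t)
      then have "t powi (-1) = cnj t"
        by (simp add: power_int_minus inverse_eq_divide complex_div_cnj[of 1])
      moreover have "complex_of_real (h t) = (u - \<i> * v) / 2 * t + (u + \<i> * v) / 2 * cnj t"
        by (subst h) (simp add: complex_eq_iff u_def v_def field_simps)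
      ultimately show ?case by (simp add: algebra_simps)
    qed
  qed
next
  case (const c)
  then show ?case by (rule fourier_null_cmult)
next
  case (add g h)
  then show ?case by (auto simp: ring_distribs intro: fourier_null_add)
next
  case (mult g h)
  from mult.IH(1)[OF mult.IH(2)[OF mult.prems]] show ?case by (simp add: mult.assoc)
qed

text \<open>Stone-Weierstrass on the circle: h is uniformly within e of a polynomial g, the integral
  of g * f vanishes, and the error is at most e times the integral of |f|.\<close>

lemma fourier_null_integral_continuous:
  fixes h :: "complex \<Rightarrow> real"
  assumes h: "continuous_on UNIV h" and f: "fourier_null f"
  shows "(LINT t|circle. of_real (h t) * f t) = 0"
proof (rule ccontr)
  assume nz: "(LINT t|circle. of_real (h t) * f t) \<noteq> 0" (is "?I \<noteq> 0")
  define N where "N = (LINT t|circle. norm (f t))"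
  have N: "N \<ge> 0" by (simp add: N_def)
  \<comment> \<open>This choice gives e * N < norm of the integral, the contradiction sought; the
    added 1 covers N = 0.\<close>
  define e where "e = norm ?I / (N + 1)"
  have e: "e > 0" using nz N by (simp add: e_def)
  obtain g where g: "real_polynomial_function g" "\<And>t. t \<in> sphere 0 1 \<Longrightarrow> \<bar>h t - g t\<bar> < e"
    using Stone_Weierstrass_real_polynomial_function[OF compact_sphere continuous_on_subset[OF h] e]
    by blast
  have intf: "integrable circle f" using f by (simp add: fourier_null_def)
  have gf: "fourier_null (\<lambda>t. of_real (g t) * f t)" by (rule fourier_null_real_polynomial[OF g(1) f])
  have meas: "(\<lambda>t. complex_of_real (h t)) \<in> borel_measurable circle"
    by (rule measurable_compose[OF circle_measurable_self])
      (intro borel_measurable_continuous_onI continuous_on_of_real h)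
  have "compact (h ` sphere 0 1)"
    by (intro compact_continuous_image continuous_on_subset[OF h]) auto
  then obtain B where "\<And>t. t \<in> sphere 0 1 \<Longrightarrow> \<bar>h t\<bar> \<le> B"
    using compact_imp_bounded by (force simp: bounded_iff)
  then have hf: "integrable circle (\<lambda>t. of_real (h t) * f t)"
    by (intro integrable_circle_bounded_mult[OF intf meas, of B] AE_I2) (simp add: space_circle)
  have igf: "integrable circle (\<lambda>t. of_real (g t) * f t)" using gf by (simp add: fourier_null_def)
  \<comment> \<open>The moment of exponent 0 is the integral itself.\<close>
  have "(LINT t|circle. of_real (g t) * f t * t powi 0) = 0"
    using gf unfolding fourier_null_def by blast
  then have "(LINT t|circle. of_real (g t) * f t) = 0" by simp
  then have "?I = (LINT t|circle. of_real (h t) * f t - of_real (g t) * f t)"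
    using hf igf by simp
  then have "norm ?I \<le> (LINT t|circle. norm (of_real (h t) * f t - of_real (g t) * f t))"
    by (metis integral_norm_bound)
  also have "\<dots> \<le> (LINT t|circle. e * norm (f t))"
  proof (rule integral_mono)
    fix t assume "t \<in> space circle"
    then have "norm (complex_of_real (h t - g t)) \<le> e"
      using g(2)[of t] unfolding norm_of_real by (simp add: space_circle)
    then show "norm (of_real (h t) * f t - of_real (g t) * f t) \<le> e * norm (f t)"
      unfolding left_diff_distrib[symmetric] of_real_diff[symmetric] norm_mult
      by (intro mult_right_mono) auto
  qed (use hf igf intf in auto)
  also have "\<dots> = e * N" by (simp add: N_def)
  also have "\<dots> < norm ?I" using nz N by (simp add: e_def field_simps)
  finally show False by simp
qed

text \<open>The indicator of a closed set is the pointwise limit of the continuous tents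
  \<open>h n\<close>, which take values in [0, 1]; dominated convergence with bound |f| carries the
  vanishing over.\<close>

lemma fourier_null_integral_closed:
  assumes "closed F" and f: "fourier_null f"
  shows "(LINT t|circle. indicator F t * f t) = 0"
proof (cases "F = {}")
  \<comment> \<open>The empty set is treated apart because \<open>infdist\<close> to it is 0 by
    convention, which would make every tent constantly 1.\<close>
  case False
  define h where "h n t = max 0 (1 - real n * infdist t F)" for n and t :: complex
  have cont: "continuous_on UNIV (h n)" for n
    unfolding h_def by (intro continuous_intros)
  have [measurable]: "f \<in> borel_measurable circle" and intf: "integrable circle f"
    using f by (auto simp: fourier_null_def)
  have [measurable]: "h n \<in> borel_measurable circle" for n
    by (intro measurable_compose[OF circle_measurable_self] borel_measurable_continuous_onI cont)
  have [measurable]: "(indicator F :: complex \<Rightarrow> complex) \<in> borel_measurable circle"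
    by (intro measurable_compose[OF circle_measurable_self] borel_measurable_indicator)
      (simp add: \<open>closed F\<close>)
  have lim: "(\<lambda>n. complex_of_real (h n t)) \<longlonglongrightarrow> indicator F t" for t
  proof (cases "t \<in> F")
    case True
    then show ?thesis by (simp add: h_def)
  next
    case notin: False
    then have pos: "infdist t F > 0"
      using assms(1) False infdist_nonneg[of t F] in_closed_iff_infdist_zero[of F t] by linarith
    \<comment> \<open>The tent vanishes at t as soon as n is at least 1 /
      \<open>infdist t F\<close>.\<close>
    have "eventually (\<lambda>n. complex_of_real (h n t) = indicator F t) sequentially"
      using eventually_ge_at_top[of "nat \<lceil>1 / infdist t F\<rceil>"]
    proof eventually_elim
      case (elim n)
      then have "1 / infdist t F \<le> real n" by linarith
      then have "1 \<le> real n * infdist t F" using pos by (simp add: field_simps)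
      then show ?case using notin by (simp add: h_def)
    qed
    then show ?thesis by (rule tendsto_eventually)
  qed
  have "(\<lambda>n. LINT t|circle. of_real (h n t) * f t) \<longlonglongrightarrow> (LINT t|circle. indicator F t * f t)"
  proof (rule integral_dominated_convergence)
    show "integrable circle (\<lambda>t. norm (f t))" using intf by simp
    show "AE t in circle. (\<lambda>n. of_real (h n t) * f t) \<longlonglongrightarrow> indicator F t * f t"
      by (intro AE_I2 tendsto_intros lim)
    have "\<bar>h n t\<bar> \<le> 1" for n t by (simp add: h_def infdist_nonneg)
    then show "AE t in circle. norm (of_real (h n t) * f t) \<le> norm (f t)" for n
      by (intro AE_I2) (auto simp: norm_mult intro: mult_left_le_one_le)
  qed measurable
  then show ?thesis
    by (simp add: fourier_null_integral_continuous[OF cont f] LIMSEQ_const_iff)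
qed simp

text \<open>A Dynkin system argument: closed sets form an intersection-stable generator of the Borel
  sets, and vanishing of the integral of f passes to complements and countable disjoint unions. A
  function whose integral over every measurable set is 0 vanishes almost everywhere.\<close>

lemma fourier_null_AE_zero:
  assumes f: "fourier_null f"
  shows "AE t in circle. f t = 0"
proof (rule circle.density_zero)
  show intf: "integrable circle f" using f by (simp add: fourier_null_def)
  \<comment> \<open>The measurable sets of \<open>circle\<close> are traces on the sphere, so the
    induction runs over Borel sets A of the plane and integrates over A \<inter>
    \<open>sphere 0 1\<close>.\<close>
  have sets: "A \<inter> sphere 0 1 \<in> sets circle" if "A \<in> sets borel" for A
    using that by (auto simp: sets_circle sets_restrict_space)
  have si: "set_integrable circle (A \<inter> sphere 0 1) f" if "A \<in> sets borel" for A
    unfolding set_integrable_def by (intro integrable_mult_indicator sets that intf)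
  have sphere: "(LINT t:(A \<inter> sphere 0 1)|circle. f t) = (LINT t|circle. indicator A t * f t)" for A
    unfolding set_lebesgue_integral_def
    by (rule Bochner_Integration.integral_cong) (auto simp: space_circle indicator_def)
  have zero: "(LINT t:(A \<inter> sphere 0 1)|circle. f t) = 0" if "A \<in> sets borel" for A
  proof -
    have "A \<in> sigma_sets UNIV (Collect closed)" using that by (simp add: borel_eq_closed)
    then show ?thesis
    proof (rule sigma_sets_induct_disjoint[of "Collect closed" UNIV, rotated 2])
      show "Int_stable (Collect closed :: complex set set)" by (auto simp: Int_stable_def)
      show "(LINT t:(B \<inter> sphere 0 1)|circle. f t) = 0" if "B \<in> Collect closed" for B
        using that by (simp add: sphere fourier_null_integral_closed[OF _ f])
    next
      fix B assume "B \<in> sigma_sets UNIV (Collect closed)"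
        and 0: "(LINT t:(B \<inter> sphere 0 1)|circle. f t) = 0"
      then have B: "B \<in> sets borel" by (simp add: borel_eq_closed)
      have "(LINT t:((B \<inter> sphere 0 1) \<union> ((UNIV - B) \<inter> sphere 0 1))|circle. f t)
          = (LINT t:(B \<inter> sphere 0 1)|circle. f t) + (LINT t:((UNIV - B) \<inter> sphere 0 1)|circle. f t)"
        using B by (intro set_integral_Un si) auto
      also have "(B \<inter> sphere 0 1) \<union> ((UNIV - B) \<inter> sphere 0 1) = UNIV \<inter> sphere 0 1" by auto
      \<comment> \<open>The whole plane is closed, so the total integral vanishes and complements
        follow by additivity.\<close>
      also have "(LINT t:(UNIV \<inter> sphere 0 1)|circle. f t) = 0"
        unfolding sphere by (rule fourier_null_integral_closed[OF _ f]) simp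
      finally show "(LINT t:((UNIV - B) \<inter> sphere 0 1)|circle. f t) = 0" using 0 by simp
    next
      fix B :: "nat \<Rightarrow> complex set"
      assume disj: "disjoint_family B" and "range B \<subseteq> sigma_sets UNIV (Collect closed)"
        and 0: "\<And>i. (LINT t:(B i \<inter> sphere 0 1)|circle. f t) = 0"
      then have B: "B i \<in> sets borel" for i by (auto simp: borel_eq_closed)
      have U: "(\<Union>i. B i) \<inter> sphere 0 1 = (\<Union>i. B i \<inter> sphere 0 1)" by auto
      have "(LINT t:(\<Union>i. B i \<inter> sphere 0 1)|circle. f t)
          = (\<Sum>i. LINT t:(B i \<inter> sphere 0 1)|circle. f t)"
      proof (rule lebesgue_integral_countable_add)
        show "set_integrable circle (\<Union>i. B i \<inter> sphere 0 1) f"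
          unfolding U[symmetric] by (rule si) (use B in auto)
      qed (use disj sets[OF B] in \<open>auto simp: disjoint_family_on_def\<close>)
      then show "(LINT t:((\<Union>i. B i) \<inter> sphere 0 1)|circle. f t) = 0"
        unfolding U by (simp add: 0)
    qed (auto simp: set_lebesgue_integral_def)
  qed
  show "set_lebesgue_integral circle A f = 0" if "A \<in> sets circle" for A
  proof -
    from that obtain A' where "A' \<in> sets borel" "A = A' \<inter> sphere 0 1"
      by (auto simp: sets_circle sets_restrict_space)
    with zero show ?thesis by simp
  qed
qed

section \<open>Lebesgue spaces\<close>

text \<open>The total mass is finite and |x| \<le> 1 + |x|^p.\<close>

lemma in_Lp_integrable:
  assumes "1 < p" "f \<in> borel_measurable circle" "integrable circle (\<lambda>t. norm (f t :: complex) powr p)"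
  shows "integrable circle f"
proof (rule Bochner_Integration.integrable_bound)
  show "integrable circle (\<lambda>t. 1 + norm (f t) powr p)" using assms by simp
  show "AE t in circle. norm (f t) \<le> norm (1 + norm (f t) powr p)"
  proof (rule AE_I2)
    fix t
    show "norm (f t) \<le> norm (1 + norm (f t) powr p)"
    proof (cases "norm (f t) \<le> 1")
      case False
      then have "norm (f t) powr 1 \<le> norm (f t) powr p"
        using assms(1) by (intro powr_mono) auto
      with False show ?thesis by simp
    qed (use powr_ge_zero[of "norm (f t)" p] in \<open>simp add: add_increasing2\<close>)
  qed
qed (rule assms)

text \<open>Uses |x + y| \<le> 2 max(|x|, |y|), which is where the factor 2^p comes from.\<close>

lemma Lp_add:
  assumes "1 < p" "f \<in> Lp p" "g \<in> Lp p"
  shows "f + g \<in> Lp p"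
  using assms unfolding Lp_def mem_Collect_eq
proof transfer
  fix p :: real and f g :: "complex \<Rightarrow> complex"
  assume p: "1 < p" and "circle_eq f f" "circle_eq g g"
    and i: "integrable circle (\<lambda>t. norm (f t) powr p)" "integrable circle (\<lambda>t. norm (g t) powr p)"
  then have [measurable]: "f \<in> borel_measurable circle" "g \<in> borel_measurable circle"
    by (auto simp: circle_eq_def)
  show "integrable circle (\<lambda>t. norm (f t + g t) powr p)"
  proof (rule Bochner_Integration.integrable_bound)
    show "integrable circle (\<lambda>t. 2 powr p * (norm (f t) powr p + norm (g t) powr p))"
      using i by simp
    show "AE t in circle. norm (norm (f t + g t) powr p)
        \<le> norm (2 powr p * (norm (f t) powr p + norm (g t) powr p))"
    proof (rule AE_I2)
      fix t
      have "norm (f t + g t) powr p \<le> (2 * max (norm (f t)) (norm (g t))) powr p"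
        using p norm_triangle_ineq[of "f t" "g t"] by (intro powr_mono2) auto
      also have "\<dots> = 2 powr p * max (norm (f t)) (norm (g t)) powr p"
        by (simp add: powr_mult le_max_iff_disj)
      also have "\<dots> \<le> 2 powr p * (norm (f t) powr p + norm (g t) powr p)"
        by (intro mult_left_mono) (auto simp: max_def)
      finally show "norm (norm (f t + g t) powr p)
        \<le> norm (2 powr p * (norm (f t) powr p + norm (g t) powr p))" by simp
    qed
  qed measurable
qed

lemma Linf_mult_Lp:
  assumes "1 < p" "a \<in> Linf" "f \<in> Lp p"
  shows "a * f \<in> Lp p"
  using assms unfolding Lp_def Linf_def mem_Collect_eq
proof transfer
  fix p :: real and a f :: "complex \<Rightarrow> complex"
  assume p: "1 < p" and "circle_eq a a" "circle_eq f f"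
    and "\<exists>B. AE t in circle. norm (a t) \<le> B"
    and i: "integrable circle (\<lambda>t. norm (f t) powr p)"
  then obtain B where [measurable]: "a \<in> borel_measurable circle" "f \<in> borel_measurable circle"
    and B: "AE t in circle. norm (a t) \<le> B" by (auto simp: circle_eq_def)
  show "integrable circle (\<lambda>t. norm (a t * f t) powr p)"
  proof (rule Bochner_Integration.integrable_bound)
    show "integrable circle (\<lambda>t. B powr p * norm (f t) powr p)" using i by simp
    show "AE t in circle. norm (norm (a t * f t) powr p) \<le> norm (B powr p * norm (f t) powr p)"
      using B
    proof eventually_elim
      case (elim t)
      then have "norm (a t) powr p \<le> B powr p" using p by (intro powr_mono2) auto
      then show ?case by (auto simp: norm_mult powr_mult intro: mult_right_mono)
    qed
  qed measurable
qed

lemma Lp_cscale: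
  assumes "f \<in> Lp p"
  shows "cscale z f \<in> Lp p"
  using assms unfolding Lp_def mem_Collect_eq
  by transfer (simp add: norm_mult powr_mult)

lemma Lp_flip:
  assumes "f \<in> Lp p"
  shows "flip f \<in> Lp p"
  using assms unfolding Lp_def mem_Collect_eq
proof transfer
  fix p :: real and f :: "complex \<Rightarrow> complex"
  assume "circle_eq f f" and i: "integrable circle (\<lambda>t. norm (f t) powr p)"
  then have [measurable]: "f \<in> borel_measurable circle" by (simp add: circle_eq_def)
  have "integrable (distr circle circle cnj) (\<lambda>t. norm (f t) powr p)"
    using i by (simp add: distr_cnj_circle)
  then have "integrable circle (\<lambda>t. norm (f (cnj t)) powr p)"
    by (subst (asm) integrable_distr_eq) (auto intro: cnj_measurable_circle)
  moreover have "integrable circle (\<lambda>t. norm (cnj t * f (cnj t)) powr p)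
      \<longleftrightarrow> integrable circle (\<lambda>t. norm (f (cnj t)) powr p)"
    by (intro Bochner_Integration.integrable_cong) (auto simp: space_circle norm_mult)
  ultimately show "integrable circle (\<lambda>t. norm (cnj t * f (cnj t)) powr p)" by simp
qed

lemma zero_in_Lp: "0 \<in> Lp p"
  unfolding Lp_def mem_Collect_eq by transfer simp

section \<open>Fourier coefficients on the quotient type\<close>

lemma fourier_coeff_zero [simp]: "fourier_coeff 0 n = 0"
  by transfer simp

lemma fourier_coeff_cscale: "fourier_coeff (cscale z f) n = z * fourier_coeff f n"
  by transfer (simp add: mult.assoc)

text \<open>Membership in \<open>Lp p\<close> supplies the integrability that additivity rests on,
  since the Bochner integral of a non-integrable function is 0 by default.\<close>

lemma fourier_coeff_add:
  assumes "1 < p" "f \<in> Lp p" "g \<in> Lp p"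
  shows "fourier_coeff (f + g) n = fourier_coeff f n + fourier_coeff g n"
  using assms unfolding Lp_def mem_Collect_eq
proof transfer
  fix p :: real and f g :: "complex \<Rightarrow> complex" and n :: int
  assume "1 < p" "circle_eq f f" "circle_eq g g" "integrable circle (\<lambda>t. norm (f t) powr p)"
    "integrable circle (\<lambda>t. norm (g t) powr p)"
  then have "integrable circle f" "integrable circle g"
    by (auto simp: circle_eq_def intro: in_Lp_integrable)
  then show "(LINT t|circle. (f t + g t) * t powi - n)
      = (LINT t|circle. f t * t powi - n) + (LINT t|circle. g t * t powi - n)"
    by (simp add: ring_distribs integrable_circle_powi)
qed

text \<open>Conjugation preserves the measure and turns index n into -n; the extra factor
  \<open>cnj t\<close> shifts by one. Hence \<open>flip\<close> exchanges the indices n \<ge> 0 with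
  the indices n < 0 exactly, with no overlap at 0.\<close>

lemma fourier_coeff_flip: "fourier_coeff (flip f) n = fourier_coeff f (- n - 1)"
proof transfer
  fix f :: "complex \<Rightarrow> complex" and n :: int
  assume "circle_eq f f"
  then have [measurable]: "f \<in> borel_measurable circle" by (simp add: circle_eq_def)
  have "(LINT t|circle. f t * t powi - (- n - 1))
      = (LINT t|distr circle circle cnj. f t * t powi - (- n - 1))"
    by (simp add: distr_cnj_circle)
  also have "\<dots> = (LINT t|circle. f (cnj t) * cnj t powi - (- n - 1))"
    by (rule integral_distr[OF cnj_measurable_circle]) measurable
  also have "\<dots> = (LINT t|circle. cnj t * f (cnj t) * t powi - n)"
  proof (rule Bochner_Integration.integral_cong)
    fix t assume "t \<in> space circle"
    then have t: "inverse t = cnj t" "t \<noteq> 0"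
      by (auto simp: space_circle inverse_eq_divide complex_div_cnj[of 1])
    have "cnj t powi - (- n - 1) = cnj t * cnj t powi n"
      using t(2) by (simp add: power_int_add)
    also have "cnj t powi n = t powi - n"
      by (simp add: power_int_inverse power_int_minus flip: t(1))
    finally show "f (cnj t) * cnj t powi - (- n - 1) = cnj t * f (cnj t) * t powi - n" by simp
  qed simp
  finally show "(LINT t|circle. cnj t * f (cnj t) * t powi - n)
      = (LINT t|circle. f t * t powi - (- n - 1))" by simp
qed

lemma Lp_eq_0I:
  assumes "1 < p" "f \<in> Lp p" "\<And>n. fourier_coeff f n = 0"
  shows "f = 0"
  using assms unfolding Lp_def mem_Collect_eq
proof transfer
  fix p :: real and f :: "complex \<Rightarrow> complex"
  assume p: "1 < p" and eq: "circle_eq f f" and i: "integrable circle (\<lambda>t. norm (f t) powr p)"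
    and 0: "\<And>n. (LINT t|circle. f t * t powi - n) = 0"
  have "(LINT t|circle. f t * t powi n) = 0" for n using 0[of "- n"] by simp
  with p eq i have "fourier_null f"
    by (auto simp: fourier_null_def circle_eq_def intro: in_Lp_integrable)
  with eq show "circle_eq f (\<lambda>_. 0)"
    by (simp add: circle_eq_def fourier_null_AE_zero)
qed

section \<open>Algebra of \<open>cscale\<close>, \<open>flip\<close> and
  \<open>tilde\<close>\<close>

interpretation circle_fun: vector_space cscale
  by (rule vector_space_cscale)

text \<open>Lets facts about negatives be read off from facts about scaling.\<close>

lemma cscale_minus_one: "- f = cscale (- 1) f"
  by transfer (rule circle_eq_pointwise; simp add: circle_eq_def)

lemma times_cscale: "g * cscale z f = cscale z (g * f)"
  by transfer (rule circle_eq_pointwise; simp add: circle_eq_def)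

lemma cscale_half_double: "cscale (1/2) (2 * f) = f"
  unfolding mult_2 circle_fun.scale_right_distrib circle_fun.scale_left_distrib[symmetric] by simp

lemma flip_add: "flip (f + g) = flip f + flip g"
proof transfer
  fix f g :: "complex \<Rightarrow> complex"
  assume "circle_eq f f" "circle_eq g g"
  then have [measurable]: "f \<in> borel_measurable circle" "g \<in> borel_measurable circle"
    by (auto simp: circle_eq_def)
  show "circle_eq (\<lambda>t. cnj t * (f (cnj t) + g (cnj t))) (\<lambda>t. cnj t * f (cnj t) + cnj t * g (cnj t))"
    by (rule circle_eq_pointwise) (simp_all add: ring_distribs)
qed

lemma flip_cscale: "flip (cscale z f) = cscale z (flip f)"
proof transfer
  fix z and f :: "complex \<Rightarrow> complex"
  assume "circle_eq f f"
  then have [measurable]: "f \<in> borel_measurable circle"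
    by (auto simp: circle_eq_def)
  show "circle_eq (\<lambda>t. cnj t * (z * f (cnj t))) (\<lambda>t. z * (cnj t * f (cnj t)))"
    by (rule circle_eq_pointwise) simp_all
qed

lemma flip_flip: "flip (flip f) = f"
proof transfer
  fix f :: "complex \<Rightarrow> complex"
  assume "circle_eq f f"
  then have [measurable]: "f \<in> borel_measurable circle" by (simp add: circle_eq_def)
  have "AE t in circle. cnj t * (cnj (cnj t) * f (cnj (cnj t))) = f t"
    using AE_circle_norm
    by eventually_elim
      (simp add: mult.assoc[symmetric] mult.commute[of "cnj _"] flip: complex_norm_square)
  then show "circle_eq (\<lambda>t. cnj t * (cnj (cnj t) * f (cnj (cnj t)))) f"
    by (simp add: circle_eq_def)
qed

text \<open>\<open>flip\<close> reflects by \<open>cnj t\<close> and \<open>tilde\<close> by 1 / t;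
  the two agree on the circle.\<close>

lemma flip_mult: "flip (g * f) = tilde g * flip f"
proof transfer
  fix g f :: "complex \<Rightarrow> complex"
  assume "circle_eq g g" "circle_eq f f"
  then have [measurable]: "g \<in> borel_measurable circle" "f \<in> borel_measurable circle"
    by (auto simp: circle_eq_def)
  have "AE t in circle. cnj t * (g (cnj t) * f (cnj t)) = g (1 / t) * (cnj t * f (cnj t))"
    using AE_circle_norm by eventually_elim (simp add: complex_div_cnj[of 1])
  then show "circle_eq (\<lambda>t. cnj t * (g (cnj t) * f (cnj t))) (\<lambda>t. g (1 / t) * (cnj t * f (cnj t)))"
    by (simp add: circle_eq_def)
qed

lemma tilde_mult: "tilde (f * g) = tilde f * tilde g"
proof transfer
  fix f g :: "complex \<Rightarrow> complex"
  assume "circle_eq f f" "circle_eq g g"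
  then have [measurable]: "f \<in> borel_measurable circle" "g \<in> borel_measurable circle"
    by (auto simp: circle_eq_def)
  show "circle_eq (\<lambda>t. f (1 / t) * g (1 / t)) (\<lambda>t. f (1 / t) * g (1 / t))"
    by (rule circle_eq_pointwise) simp_all
qed

lemma tilde_one: "tilde 1 = 1"
  by transfer (simp add: circle_eq_def)

lemma Linf_tilde:
  assumes "a \<in> Linf"
  shows "tilde a \<in> Linf"
  using assms unfolding Linf_def mem_Collect_eq
  by transfer (use AE_circle_inverse in fast)

lemma Linf_mult:
  assumes "a \<in> Linf" "b \<in> Linf"
  shows "a * b \<in> Linf"
  using assms unfolding Linf_def mem_Collect_eq
proof transfer
  fix a b :: "complex \<Rightarrow> complex"
  assume "\<exists>B. AE t in circle. norm (a t) \<le> B" "\<exists>B. AE t in circle. norm (b t) \<le> B"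
  then obtain A B where "AE t in circle. norm (a t) \<le> A" "AE t in circle. norm (b t) \<le> B" by blast
  then have "AE t in circle. norm (a t * b t) \<le> A * B"
  proof eventually_elim
    case (elim t)
    then show ?case unfolding norm_mult by (intro mult_mono) (auto intro: order_trans[OF norm_ge_zero])
  qed
  then show "\<exists>B. AE t in circle. norm (a t * b t) \<le> B" by blast
qed

text \<open>Links the pointwise inverse in \<open>subordinated_pair\<close> to inverses in the
  ring.\<close>

lemma circle_fun_inverse_unique:
  assumes "f * g = (1 :: circle_fun)"
  shows "inverse f = g"
  using assms
proof transfer
  fix f g :: "complex \<Rightarrow> complex"
  assume "circle_eq f f" "circle_eq g g" "circle_eq (\<lambda>t. f t * g t) (\<lambda>_. 1)"
  then show "circle_eq (\<lambda>t. inverse (f t)) g"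
    by (auto simp: circle_eq_def elim!: eventually_mono intro: inverse_unique)
qed


section \<open>Kernels of Toeplitz operators\<close>

lemma fourier_coeff_uminus: "fourier_coeff (- f) n = - fourier_coeff f n"
  by (subst cscale_minus_one, subst fourier_coeff_cscale) simp

lemma hardy_add: "1 < p \<Longrightarrow> f \<in> hardy p \<Longrightarrow> g \<in> hardy p \<Longrightarrow> f + g \<in> hardy p"
  by (auto simp: hardy_def Lp_add fourier_coeff_add)

lemma hardy_cscale: "f \<in> hardy p \<Longrightarrow> cscale z f \<in> hardy p"
  by (auto simp: hardy_def Lp_cscale fourier_coeff_cscale)

lemma hardy_uminus: "f \<in> hardy p \<Longrightarrow> - f \<in> hardy p"
  unfolding cscale_minus_one by (rule hardy_cscale)

lemma zero_in_hardy: "0 \<in> hardy p"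
  by (simp add: hardy_def zero_in_Lp)

text \<open>Two candidates differ by a function with no Fourier coefficients: those of negative
  index vanish by membership in \<open>hardy p\<close>, the others by agreement with f. So
  exhibiting one candidate settles the definite description.\<close>

lemma riesz_P_eqI:
  assumes p: "1 < p" and g: "g \<in> hardy p" "\<And>n. 0 \<le> n \<Longrightarrow> fourier_coeff g n = fourier_coeff f n"
  shows "riesz_P p f = g"
proof -
  have uniq: "h = g" if h: "h \<in> hardy p" "\<forall>n\<ge>0. fourier_coeff h n = fourier_coeff f n" for h
  proof -
    have "h + - g = 0"
    proof (rule Lp_eq_0I[OF p])
      show "h + - g \<in> Lp p"
        using hardy_add[OF p h(1) hardy_uminus[OF g(1)]] by (simp add: hardy_def)
      have "h \<in> Lp p" "- g \<in> Lp p" using h(1) hardy_uminus[OF g(1)] by (auto simp: hardy_def)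
      then have "fourier_coeff (h + - g) n = fourier_coeff h n - fourier_coeff g n" for n
        by (simp only: fourier_coeff_add[OF p] fourier_coeff_uminus) simp
      then show "fourier_coeff (h + - g) n = 0" for n
        using g h by (cases "n < 0") (auto simp: hardy_def)
    qed
    then show ?thesis by simp
  qed
  then have "\<exists>!g. g \<in> hardy p \<and> (\<forall>n\<ge>0. fourier_coeff g n = fourier_coeff f n)"
    using g by blast
  then have "riesz_P p f = (THE g. g \<in> hardy p \<and> (\<forall>n\<ge>0. fourier_coeff g n = fourier_coeff f n))"
    unfolding riesz_P_def by (rule if_P)
  also have "\<dots> = g" using uniq g by (intro the_equality) blast+
  finally show ?thesis .
qed

text \<open>Oddness holds also on the junk branch of \<^const>\<open>riesz_P\<close>; this is why the existence of the
  Riesz projection is never needed.\<close>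

lemma riesz_P_uminus:
  assumes p: "1 < p"
  shows "riesz_P p (- f) = - riesz_P p f"
proof (cases "\<exists>g. g \<in> hardy p \<and> (\<forall>n\<ge>0. fourier_coeff g n = fourier_coeff f n)")
  case True
  then obtain g where g: "g \<in> hardy p" "\<forall>n\<ge>0. fourier_coeff g n = fourier_coeff f n" by blast
  then have "riesz_P p f = g" by (intro riesz_P_eqI[OF p]) auto
  moreover have "riesz_P p (- f) = - g"
    using g by (intro riesz_P_eqI[OF p] hardy_uminus) (auto simp: fourier_coeff_uminus)
  ultimately show ?thesis by simp
next
  case False
  have "\<not> (g \<in> hardy p \<and> (\<forall>n\<ge>0. fourier_coeff g n = fourier_coeff (- f) n))" for g
  proof
    assume "g \<in> hardy p \<and> (\<forall>n\<ge>0. fourier_coeff g n = fourier_coeff (- f) n)"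
    then have "- g \<in> hardy p \<and> (\<forall>n\<ge>0. fourier_coeff (- g) n = fourier_coeff f n)"
      by (auto simp: hardy_uminus fourier_coeff_uminus)
    with False show False by blast
  qed
  then have "\<not> (\<exists>!g. g \<in> hardy p \<and> (\<forall>n\<ge>0. fourier_coeff g n = fourier_coeff (- f) n))"
    by blast
  moreover have "\<not> (\<exists>!g. g \<in> hardy p \<and> (\<forall>n\<ge>0. fourier_coeff g n = fourier_coeff f n))"
    using False by blast
  ultimately show ?thesis unfolding riesz_P_def by (simp only: if_False)
qed

text \<open>Forward, the value 0 either carries the coefficients of f for n \<ge> 0 or, on the else
  branch, is f itself. Backward, 0 is a valid candidate.\<close>

lemma riesz_P_eq_0_iff:
  assumes p: "1 < p"
  shows "riesz_P p f = 0 \<longleftrightarrow> (\<forall>n\<ge>0. fourier_coeff f n = 0)"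
proof
  assume 0: "riesz_P p f = 0"
  show "\<forall>n\<ge>0. fourier_coeff f n = 0"
  proof (cases "\<exists>!g. g \<in> hardy p \<and> (\<forall>n\<ge>0. fourier_coeff g n = fourier_coeff f n)")
    case True
    from theI'[OF this] 0 True show ?thesis by (simp add: riesz_P_def)
  next
    case False
    with 0 show ?thesis by (simp add: riesz_P_def)
  qed
qed (auto intro: riesz_P_eqI[OF p] simp: zero_in_hardy)

text \<open>For f in \<open>hardy p\<close>, \<open>flip f\<close> has only coefficients of negative
  index. This removes Q from the Hankel operator.\<close>

lemma riesz_Q_flip:
  assumes "1 < p" "f \<in> hardy p"
  shows "riesz_Q p (flip f) = flip f"
proof -
  have "riesz_P p (flip f) = 0"
    using assms by (simp add: riesz_P_eq_0_iff fourier_coeff_flip hardy_def)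
  then show ?thesis by (simp add: riesz_Q_def)
qed

section \<open>The involution on the kernel of T(g) when g * \<open>tilde g\<close> = 1\<close>

locale toeplitz_symbol =
  fixes p :: real and g :: circle_fun
  assumes p: "1 < p" and g: "g \<in> Linf" and g_tilde: "g * tilde g = 1"
begin

abbreviation "K \<equiv> hardy_ker p (toeplitz p g)"

lemma ker_iff: "f \<in> K \<longleftrightarrow> f \<in> hardy p \<and> (\<forall>n\<ge>0. fourier_coeff (g * f) n = 0)"
  by (simp add: hardy_ker_def toeplitz_def riesz_P_eq_0_iff[OF p])

lemma ker_add:
  assumes "f \<in> K" "h \<in> K"
  shows "f + h \<in> K"
proof -
  have "g * f \<in> Lp p" "g * h \<in> Lp p"
    using assms by (auto simp: ker_iff hardy_def intro: Linf_mult_Lp[OF p g])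
  with assms show ?thesis
    by (auto simp: ker_iff ring_distribs hardy_add[OF p] fourier_coeff_add[OF p])
qed

lemma ker_cscale: "f \<in> K \<Longrightarrow> cscale z f \<in> K"
  by (auto simp: ker_iff times_cscale hardy_cscale fourier_coeff_cscale)

lemma ker_uminus: "f \<in> K \<Longrightarrow> - f \<in> K"
  unfolding cscale_minus_one by (rule ker_cscale)

lemma zero_in_ker: "0 \<in> K"
  by (simp add: ker_iff zero_in_hardy)

text \<open>On the kernel, P fixes f and annihilates g * f, so Q fixes g * f.\<close>

lemma bold_P_ker:
  assumes "f \<in> K"
  shows "bold_P p g f = flip (g * f)"
proof -
  have "riesz_P p f = f" using assms by (intro riesz_P_eqI[OF p]) (auto simp: ker_iff)
  then show ?thesis
    using assms by (simp add: bold_P_def riesz_Q_def hardy_ker_def toeplitz_def)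
qed

text \<open>The one place where g * \<open>tilde g\<close> = 1 acts; both invariance of the kernel
  and the involution property come from it.\<close>

lemma mult_flip_mult: "g * flip (g * f) = flip f"
  by (simp add: flip_mult mult.assoc[symmetric] g_tilde)

text \<open>The two conditions in \<open>ker_iff\<close> trade places: vanishing of the coefficients
  of g * f for n \<ge> 0 puts \<open>flip (g * f)\<close> in \<open>hardy p\<close>, and f in
  \<open>hardy p\<close> makes those of g * \<open>flip (g * f)\<close> = \<open>flip f\<close>
  vanish for n \<ge> 0.\<close>

lemma bold_P_in_ker:
  assumes "f \<in> K"
  shows "bold_P p g f \<in> K"
proof -
  have "flip (g * f) \<in> hardy p"
    using assms by (auto simp: ker_iff hardy_def fourier_coeff_flip intro: Lp_flip Linf_mult_Lp[OF p g])
  with assms show ?thesis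
    unfolding bold_P_ker[OF assms] ker_iff mult_flip_mult
    by (simp add: fourier_coeff_flip ker_iff hardy_def)
qed

lemma bold_P_involution:
  assumes "f \<in> K"
  shows "bold_P p g (bold_P p g f) = f"
  using bold_P_ker[OF bold_P_in_ker[OF assms]]
  by (simp add: bold_P_ker[OF assms] mult_flip_mult flip_flip)

lemma bold_P_add:
  assumes "f \<in> K" "h \<in> K"
  shows "bold_P p g (f + h) = bold_P p g f + bold_P p g h"
  using assms by (simp add: bold_P_ker ker_add ring_distribs flip_add)

lemma bold_P_cscale:
  assumes "f \<in> K"
  shows "bold_P p g (cscale z f) = cscale z (bold_P p g f)"
  using assms by (simp add: bold_P_ker ker_cscale times_cscale flip_cscale)

lemma bold_P_uminus:
  assumes "f \<in> K"
  shows "bold_P p g (- f) = - bold_P p g f"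
  unfolding cscale_minus_one by (rule bold_P_cscale[OF assms])

text \<open>The involution swaps the two summands of h + \<open>bold_P p g h\<close>, so the image
  is fixed; a fixed f is its own image.\<close>

lemma im_P_plus_eq: "im_P_plus p g = {f \<in> K. bold_P p g f = f}"
proof (intro subset_antisym subsetI)
  fix f assume "f \<in> im_P_plus p g"
  then obtain h where h: "h \<in> K" "f = cscale (1/2) (h + bold_P p g h)"
    by (auto simp: im_P_plus_def bold_P_plus_def)
  then show "f \<in> {f \<in> K. bold_P p g f = f}"
    by (simp add: ker_cscale ker_add bold_P_in_ker bold_P_cscale bold_P_add bold_P_involution
        add.commute)
next
  fix f assume "f \<in> {f \<in> K. bold_P p g f = f}"
  then show "f \<in> im_P_plus p g"
    unfolding im_P_plus_def bold_P_plus_def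
    by (intro image_eqI[of _ _ f]) (simp_all add: cscale_half_double)
qed

lemma im_P_minus_eq: "im_P_minus p g = {f \<in> K. bold_P p g f = - f}"
proof (intro subset_antisym subsetI)
  fix f assume "f \<in> im_P_minus p g"
  \<comment> \<open>The difference is written as a sum with a negative so that
    \<open>bold_P_add\<close> and \<open>bold_P_uminus\<close> apply;
    \<open>add_uminus_conv_diff\<close>, deleted below, would undo this.\<close>
  then obtain h where h: "h \<in> K" "f = cscale (1/2) (h + - bold_P p g h)"
    by (auto simp: im_P_minus_def bold_P_minus_def)
  then have "bold_P p g f = cscale (1/2) (- (h + - bold_P p g h))"
    by (simp add: ker_add bold_P_in_ker bold_P_cscale bold_P_add bold_P_uminus ker_uminus
        bold_P_involution del: add_uminus_conv_diff)
  with h show "f \<in> {f \<in> K. bold_P p g f = - f}"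
    by (simp add: ker_cscale ker_add ker_uminus bold_P_in_ker circle_fun.scale_minus_right
        del: add_uminus_conv_diff minus_add_distrib)
next
  fix f assume "f \<in> {f \<in> K. bold_P p g f = - f}"
  then show "f \<in> im_P_minus p g"
    unfolding im_P_minus_def bold_P_minus_def
    by (intro image_eqI[of _ _ f]) (simp_all add: cscale_half_double)
qed

text \<open>Every f is the sum of its two projections, and a common element satisfies f = - f;
  scaling by 1/2 then gives f = 0.\<close>

lemma direct_sum_im_P: "direct_sum K (im_P_minus p g) (im_P_plus p g)"
  unfolding direct_sum_def
proof (intro conjI)
  show "circle_fun.subspace K"
    by (intro circle_fun.subspaceI zero_in_ker ker_add ker_cscale)
  have P0: "bold_P p g 0 = 0" using bold_P_add[OF zero_in_ker zero_in_ker] by simp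
  show "circle_fun.subspace (im_P_minus p g)" "circle_fun.subspace (im_P_plus p g)"
    unfolding im_P_minus_eq im_P_plus_eq
    by (intro circle_fun.subspaceI;
        simp add: P0 zero_in_ker ker_add ker_cscale bold_P_add bold_P_cscale)+
  show "K = {u + w |u w. u \<in> im_P_minus p g \<and> w \<in> im_P_plus p g}"
  proof (intro subset_antisym subsetI)
    fix f assume f: "f \<in> K"
    have "f = bold_P_minus p g f + bold_P_plus p g f"
      unfolding bold_P_minus_def bold_P_plus_def
      by (subst circle_fun.scale_right_distrib[symmetric]) (simp add: cscale_half_double)
    then show "f \<in> {u + w |u w. u \<in> im_P_minus p g \<and> w \<in> im_P_plus p g}"
      using f unfolding im_P_minus_def im_P_plus_def by blast
  qed (auto simp: im_P_minus_eq im_P_plus_eq ker_add)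
  show "im_P_minus p g \<inter> im_P_plus p g = {0}"
  proof (intro subset_antisym subsetI)
    fix f assume "f \<in> im_P_minus p g \<inter> im_P_plus p g"
    then have "bold_P p g f = - f" "bold_P p g f = f"
      unfolding im_P_minus_eq im_P_plus_eq by blast+
    then have "2 * f = 0" by (metis add.right_inverse mult_2)
    then show "f \<in> {0}" using cscale_half_double[of f] by simp
  qed (auto simp: im_P_minus_eq im_P_plus_eq zero_in_ker P0)
qed

end

section \<open>Application to the subordinated symbol c of a matching pair\<close>

theorem corollary3p5:
  fixes p :: real and a b c d :: circle_fun
  assumes "1 < p"
    and "matching_pair a b"
    and "subordinated_pair a b c d"
  shows "direct_sum (hardy_ker p (toeplitz p c)) (im_P_minus p c) (im_P_plus p c)
    \<and> im_P_minus p c \<subseteq> hardy_ker p (\<lambda>f. toeplitz p a f + hankel p b f)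
    \<and> im_P_plus p c \<subseteq> hardy_ker p (\<lambda>f. toeplitz p a f - hankel p b f)"
proof -
  from assms(2) obtain u where a: "a \<in> Linf" and b: "b \<in> Linf" and u: "u \<in> Linf" "a * u = 1"
    and ab: "a * tilde a = b * tilde b"
    by (auto simp: matching_pair_def invertible_Linf_def)
  \<comment> \<open>The inverse of b: in b * \<open>tilde b\<close> = a * \<open>tilde a\<close> the
    right side has inverse u * \<open>tilde u\<close>.\<close>
  define v where "v = tilde b * (u * tilde u)"
  have v: "v \<in> Linf" unfolding v_def by (intro Linf_mult Linf_tilde b u)
  have "b * v = (b * tilde b) * (u * tilde u)" by (simp add: v_def ac_simps)
  also have "\<dots> = (a * u) * tilde (a * u)" by (simp add: tilde_mult ac_simps flip: ab)
  finally have bv: "b * v = 1" by (simp add: u tilde_one)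
  have c: "c = a * v"
    using assms(3) circle_fun_inverse_unique[OF bv] by (simp add: subordinated_pair_def)
  have "c * tilde c = (a * tilde a) * (v * tilde v)" by (simp add: c tilde_mult ac_simps)
  also have "\<dots> = (b * v) * tilde (b * v)" by (simp add: ab tilde_mult ac_simps)
  finally have "c * tilde c = 1" by (simp add: bv tilde_one)
  then interpret toeplitz_symbol p c
    using assms(1) a v by unfold_locales (simp_all add: c Linf_mult)
  \<comment> \<open>Multiplying by b turns an identity about c * f into one about a * f.\<close>
  have bc: "b * c = a" using bv by (simp add: c ac_simps)
  have hankel: "hankel p b f = riesz_P p (b * flip f)" if "f \<in> K" for f
    using that riesz_Q_flip[OF p] by (simp add: hankel_def ker_iff)
  have flip: "flip (bold_P p c f) = c * f" if "f \<in> K" for f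
    using that by (simp add: bold_P_ker flip_flip)
  have minus: "im_P_minus p c \<subseteq> hardy_ker p (\<lambda>f. toeplitz p a f + hankel p b f)"
  proof
    fix f assume "f \<in> im_P_minus p c"
    then have f: "f \<in> K" "bold_P p c f = - f" by (auto simp: im_P_minus_eq)
    \<comment> \<open>The formula \<open>flip\<close> is applied to - f, whose image under the
      involution is f.\<close>
    then have "flip f = - (c * f)"
      using flip[OF ker_uminus[OF f(1)]] by (simp add: bold_P_uminus)
    then have "b * flip f = - (a * f)" by (simp add: bc flip: mult.assoc)
    \<comment> \<open>The sum is P(a f) + P(- a f), which vanishes because P is odd.\<close>
    then have "toeplitz p a f + hankel p b f = 0"
      by (simp add: hankel[OF f(1)] toeplitz_def riesz_P_uminus[OF p])
    with f show "f \<in> hardy_ker p (\<lambda>f. toeplitz p a f + hankel p b f)"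
      by (simp add: hardy_ker_def)
  qed
  have plus: "im_P_plus p c \<subseteq> hardy_ker p (\<lambda>f. toeplitz p a f - hankel p b f)"
  proof
    fix f assume "f \<in> im_P_plus p c"
    then have f: "f \<in> K" "bold_P p c f = f" by (auto simp: im_P_plus_eq)
    then have "flip f = c * f" using flip[OF f(1)] by simp
    then have "b * flip f = a * f" by (simp add: bc flip: mult.assoc)
    then have "toeplitz p a f - hankel p b f = 0"
      by (simp add: hankel[OF f(1)] toeplitz_def)
    with f show "f \<in> hardy_ker p (\<lambda>f. toeplitz p a f - hankel p b f)"
      by (simp add: hardy_ker_def)
  qed
  from direct_sum_im_P minus plus show ?thesis by blast
qed

end
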